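(* Let $A$ be a finite-dimensional algebra over an algebraically closed field $k$, and let $S,T$ be non-isomorphic simple reflexive left $A$-modules. Then the right $A$-modules $S^*$ and $T^*$ are orthogonal bricks.
   Context: Modules have finite length. For a left $A$-module $M$, let $M^*=\operatorname{Hom}_A(M,{}_AA)$, considered as a right $A$-module; similarly, for a right $A$-module $N$, $N^*=\operatorname{Hom}_A(N,A_A)$, considered as a left $A$-module. Let $\phi_M\colon M\to M^{**}$ be the canonical evaluation map $m\mapsto (f\mapsto f(m))$; a module $M$ is reflexive if $\phi_M$ is bijective. A brick is a module whose endomorphism ring is a division ring. Two modules $U,V$ are orthogonal if $\operatorname{Hom}_A(U,V)=0=\operatorname{Hom}_A(V,U)$. *)

theory Defs
  imports "Jordan_Normal_Form.Missing_VectorSpace" "HOL-Algebra.Algebraic_Closure"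
begin

text \<open>
  The locale \<^locale>\<open>module\<close> only covers commutative coefficient rings, so left and right modules
  over an arbitrary ring are introduced here.  Both use the record of type \<^typ>\<open>('a, 'b) module\<close>
  with the scalar as the first argument of \<^const>\<open>smult\<close>; for a right module, \<open>smult M a x\<close> stands
  for \<open>x a\<close>.  The library notions \<^const>\<open>Module.submodule\<close> and \<^const>\<open>LinearCombinations.module_hom\<close> do not
  presuppose commutativity and, with this convention, apply to left and to right modules alike.
\<close>

locale fin_dim_algebra = vectorspace K A + alg: ring A
  for K :: "('k, 'm) ring_scheme" and A :: "('k, 'a, 'n) module_scheme" +
  assumes smult_mult_left:
      "\<lbrakk>c \<in> carrier K; x \<in> carrier A; y \<in> carrier A\<rbrakk> \<Longrightarrow>
        (c \<odot>\<^bsub>A\<^esub> x) \<otimes>\<^bsub>A\<^esub> y = c \<odot>\<^bsub>A\<^esub> (x \<otimes>\<^bsub>A\<^esub> y)"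
    and smult_mult_right:
      "\<lbrakk>c \<in> carrier K; x \<in> carrier A; y \<in> carrier A\<rbrakk> \<Longrightarrow>
        x \<otimes>\<^bsub>A\<^esub> (c \<odot>\<^bsub>A\<^esub> y) = c \<odot>\<^bsub>A\<^esub> (x \<otimes>\<^bsub>A\<^esub> y)"
    and finite_dimensional: "fin_dim"

locale left_module = R?: ring A + M?: abelian_group M
  for A :: "('a, 'm) ring_scheme" and M :: "('a, 'b, 'n) module_scheme" +
  assumes smult_closed:
      "\<lbrakk>a \<in> carrier A; x \<in> carrier M\<rbrakk> \<Longrightarrow> a \<odot>\<^bsub>M\<^esub> x \<in> carrier M"
    and smult_l_distr:
      "\<lbrakk>a \<in> carrier A; b \<in> carrier A; x \<in> carrier M\<rbrakk> \<Longrightarrow>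
        (a \<oplus>\<^bsub>A\<^esub> b) \<odot>\<^bsub>M\<^esub> x = a \<odot>\<^bsub>M\<^esub> x \<oplus>\<^bsub>M\<^esub> b \<odot>\<^bsub>M\<^esub> x"
    and smult_r_distr:
      "\<lbrakk>a \<in> carrier A; x \<in> carrier M; y \<in> carrier M\<rbrakk> \<Longrightarrow>
        a \<odot>\<^bsub>M\<^esub> (x \<oplus>\<^bsub>M\<^esub> y) = a \<odot>\<^bsub>M\<^esub> x \<oplus>\<^bsub>M\<^esub> a \<odot>\<^bsub>M\<^esub> y"
    and smult_assoc:
      "\<lbrakk>a \<in> carrier A; b \<in> carrier A; x \<in> carrier M\<rbrakk> \<Longrightarrow>
        (a \<otimes>\<^bsub>A\<^esub> b) \<odot>\<^bsub>M\<^esub> x = a \<odot>\<^bsub>M\<^esub> (b \<odot>\<^bsub>M\<^esub> x)"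
    and smult_one: "x \<in> carrier M \<Longrightarrow> \<one>\<^bsub>A\<^esub> \<odot>\<^bsub>M\<^esub> x = x"

locale right_module = R?: ring A + M?: abelian_group M
  for A :: "('a, 'm) ring_scheme" and M :: "('a, 'b, 'n) module_scheme" +
  assumes smult_closed:
      "\<lbrakk>a \<in> carrier A; x \<in> carrier M\<rbrakk> \<Longrightarrow> a \<odot>\<^bsub>M\<^esub> x \<in> carrier M"
    and smult_l_distr:
      "\<lbrakk>a \<in> carrier A; b \<in> carrier A; x \<in> carrier M\<rbrakk> \<Longrightarrow>
        (a \<oplus>\<^bsub>A\<^esub> b) \<odot>\<^bsub>M\<^esub> x = a \<odot>\<^bsub>M\<^esub> x \<oplus>\<^bsub>M\<^esub> b \<odot>\<^bsub>M\<^esub> x"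
    and smult_r_distr:
      "\<lbrakk>a \<in> carrier A; x \<in> carrier M; y \<in> carrier M\<rbrakk> \<Longrightarrow>
        a \<odot>\<^bsub>M\<^esub> (x \<oplus>\<^bsub>M\<^esub> y) = a \<odot>\<^bsub>M\<^esub> x \<oplus>\<^bsub>M\<^esub> a \<odot>\<^bsub>M\<^esub> y"
    and smult_assoc:
      "\<lbrakk>a \<in> carrier A; b \<in> carrier A; x \<in> carrier M\<rbrakk> \<Longrightarrow>
        (a \<otimes>\<^bsub>A\<^esub> b) \<odot>\<^bsub>M\<^esub> x = b \<odot>\<^bsub>M\<^esub> (a \<odot>\<^bsub>M\<^esub> x)"
    and smult_one: "x \<in> carrier M \<Longrightarrow> \<one>\<^bsub>A\<^esub> \<odot>\<^bsub>M\<^esub> x = x"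

text \<open>Homomorphisms are made extensional, so that equality of homomorphisms is equality in HOL.\<close>

definition Hom ::
  "('a, 'm) ring_scheme \<Rightarrow> ('a, 'b, 'n) module_scheme \<Rightarrow> ('a, 'c, 'p) module_scheme \<Rightarrow> ('b \<Rightarrow> 'c) set"
  where "Hom A M N = LinearCombinations.module_hom A M N \<inter> extensional (carrier M)"

definition isomorphic_modules ::
  "('a, 'm) ring_scheme \<Rightarrow> ('a, 'b, 'n) module_scheme \<Rightarrow> ('a, 'c, 'p) module_scheme \<Rightarrow> bool"
  where "isomorphic_modules A M N \<longleftrightarrow> (\<exists>f \<in> Hom A M N. bij_betw f (carrier M) (carrier N))"

definition simple_left_module :: "('a, 'm) ring_scheme \<Rightarrow> ('a, 'b, 'n) module_scheme \<Rightarrow> bool"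
  where "simple_left_module A M \<longleftrightarrow>
    left_module A M \<and> carrier M \<noteq> {\<zero>\<^bsub>M\<^esub>} \<and>
    (\<forall>N. Module.submodule N A M \<longrightarrow> N = {\<zero>\<^bsub>M\<^esub>} \<or> N = carrier M)"

text \<open>Finite length: the lengths of strict chains of submodules are bounded.\<close>

definition finite_length :: "('a, 'm) ring_scheme \<Rightarrow> ('a, 'b, 'n) module_scheme \<Rightarrow> bool"
  where "finite_length A M \<longleftrightarrow>
    (\<exists>n. \<forall>Ns. (\<forall>N \<in> set Ns. Module.submodule N A M) \<and> sorted_wrt (\<subset>) Ns \<longrightarrow> length Ns \<le> n)"

lemma simple_left_module_finite_length:
  assumes "simple_left_module A M"
  shows "finite_length A M"
  unfolding finite_length_def
proof (intro exI[of _ 2] allI impI)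
  fix Ns assume Ns: "(\<forall>N \<in> set Ns. Module.submodule N A M) \<and> sorted_wrt (\<subset>) Ns"
  have "distinct Ns"
    unfolding distinct_conv_nth
    using Ns by (metis linorder_neqE_nat psubset_eq sorted_wrt_iff_nth_less)
  moreover have "set Ns \<subseteq> {{\<zero>\<^bsub>M\<^esub>}, carrier M}"
    using Ns assms by (auto simp: simple_left_module_def)
  ultimately have "length Ns \<le> card {{\<zero>\<^bsub>M\<^esub>}, carrier M}"
    by (metis card_mono distinct_card finite.emptyI finite.insertI)
  also have "\<dots> \<le> 2"
    by (simp add: card_insert_if)
  finally show "length Ns \<le> 2" .
qed

text \<open>
  The modules \<open>\<^sub>AA\<close> and \<open>A\<^sub>A\<close>.  The record fields \<^const>\<open>monoid.mult\<close> and \<^const>\<open>one\<close> play no role for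
  modules.
\<close>

definition left_regular :: "('a, 'm) ring_scheme \<Rightarrow> ('a, 'a) module"
  where "left_regular A =
    \<lparr>carrier = carrier A, monoid.mult = monoid.mult A, one = one A, zero = zero A, add = add A,
     smult = (\<lambda>a x. a \<otimes>\<^bsub>A\<^esub> x)\<rparr>"

definition right_regular :: "('a, 'm) ring_scheme \<Rightarrow> ('a, 'a) module"
  where "right_regular A =
    \<lparr>carrier = carrier A, monoid.mult = monoid.mult A, one = one A, zero = zero A, add = add A,
     smult = (\<lambda>a x. x \<otimes>\<^bsub>A\<^esub> a)\<rparr>"

text \<open>
  The dual of a left module is a right module by \<open>(f a)(m) = f(m) a\<close>; the dual of a right module
  is a left module by \<open>(a g)(n) = a g(n)\<close>.
\<close>

definition dual_of_left :: "('a, 'm) ring_scheme \<Rightarrow> ('a, 'b, 'n) module_scheme \<Rightarrow> ('a, 'b \<Rightarrow> 'a) module"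
  where "dual_of_left A M =
    \<lparr>carrier = Hom A M (left_regular A),
     monoid.mult = (\<lambda>f g. \<lambda>m\<in>carrier M. \<zero>\<^bsub>A\<^esub>), one = (\<lambda>m\<in>carrier M. \<zero>\<^bsub>A\<^esub>),
     zero = (\<lambda>m\<in>carrier M. \<zero>\<^bsub>A\<^esub>), add = (\<lambda>f g. \<lambda>m\<in>carrier M. f m \<oplus>\<^bsub>A\<^esub> g m),
     smult = (\<lambda>a f. \<lambda>m\<in>carrier M. f m \<otimes>\<^bsub>A\<^esub> a)\<rparr>"

definition dual_of_right :: "('a, 'm) ring_scheme \<Rightarrow> ('a, 'b, 'n) module_scheme \<Rightarrow> ('a, 'b \<Rightarrow> 'a) module"
  where "dual_of_right A N =
    \<lparr>carrier = Hom A N (right_regular A),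
     monoid.mult = (\<lambda>f g. \<lambda>n\<in>carrier N. \<zero>\<^bsub>A\<^esub>), one = (\<lambda>n\<in>carrier N. \<zero>\<^bsub>A\<^esub>),
     zero = (\<lambda>n\<in>carrier N. \<zero>\<^bsub>A\<^esub>), add = (\<lambda>f g. \<lambda>n\<in>carrier N. f n \<oplus>\<^bsub>A\<^esub> g n),
     smult = (\<lambda>a g. \<lambda>n\<in>carrier N. a \<otimes>\<^bsub>A\<^esub> g n)\<rparr>"

definition evaluation :: "('a, 'm) ring_scheme \<Rightarrow> ('a, 'b, 'n) module_scheme \<Rightarrow> 'b \<Rightarrow> ('b \<Rightarrow> 'a) \<Rightarrow> 'a"
  where "evaluation A M m = (\<lambda>f\<in>carrier (dual_of_left A M). f m)"

definition reflexive_left_module :: "('a, 'm) ring_scheme \<Rightarrow> ('a, 'b, 'n) module_scheme \<Rightarrow> bool"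
  where "reflexive_left_module A M \<longleftrightarrow>
    left_module A M \<and>
    bij_betw (evaluation A M) (carrier M) (carrier (dual_of_right A (dual_of_left A M)))"

definition End_ring :: "('a, 'm) ring_scheme \<Rightarrow> ('a, 'b, 'n) module_scheme \<Rightarrow> ('b \<Rightarrow> 'b) ring"
  where "End_ring A M =
    \<lparr>carrier = Hom A M M, monoid.mult = compose (carrier M), one = (\<lambda>x\<in>carrier M. x),
     zero = (\<lambda>x\<in>carrier M. \<zero>\<^bsub>M\<^esub>), add = (\<lambda>f g. \<lambda>x\<in>carrier M. f x \<oplus>\<^bsub>M\<^esub> g x)\<rparr>"

definition is_division_ring :: "('a, 'm) ring_scheme \<Rightarrow> bool"
  where "is_division_ring D \<longleftrightarrow>
    ring D \<and> \<one>\<^bsub>D\<^esub> \<noteq> \<zero>\<^bsub>D\<^esub> \<and> Units D = carrier D - {\<zero>\<^bsub>D\<^esub>}"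

text \<open>Modules are understood to have finite length, so this is part of being a brick.\<close>

definition right_brick :: "('a, 'm) ring_scheme \<Rightarrow> ('a, 'b, 'n) module_scheme \<Rightarrow> bool"
  where "right_brick A M \<longleftrightarrow>
    right_module A M \<and> finite_length A M \<and> is_division_ring (End_ring A M)"

definition orthogonal_modules ::
  "('a, 'm) ring_scheme \<Rightarrow> ('a, 'b, 'n) module_scheme \<Rightarrow> ('a, 'c, 'p) module_scheme \<Rightarrow> bool"
  where "orthogonal_modules A U V \<longleftrightarrow>
    Hom A U V = {\<lambda>x\<in>carrier U. \<zero>\<^bsub>V\<^esub>} \<and> Hom A V U = {\<lambda>x\<in>carrier V. \<zero>\<^bsub>U\<^esub>}"

end

theory Submission
  imports Defs
begin

text \<open>
  Write \<open>M\<^sup>*\<close> for the dual of \<open>M\<close>.  The whole proof rests on the contravariant functor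
  \<open>\<theta> \<mapsto> \<theta>\<^sup>*\<close> (precomposition with \<open>\<theta>\<close>, here \<open>dual_map\<close>) being full at a reflexive target: if \<open>T\<close> is
  reflexive, then every \<open>h : T\<^sup>* \<rightarrow> S\<^sup>*\<close> is \<open>\<theta>\<^sup>*\<close> for some \<open>\<theta> : S \<rightarrow> T\<close>
  (\<open>Hom_between_duals_is_dual_map\<close>).  Indeed, for fixed \<open>s\<close> in \<open>S\<close>, the assignment \<open>f \<mapsto> h(f)(s)\<close>
  is an element of \<open>T\<^sup>*\<^sup>*\<close>, hence evaluation at a unique point \<open>\<theta>(s)\<close> of \<open>T\<close>.

  By Schur's lemma, a nonzero \<open>\<theta>\<close> between simple modules is bijective.  For \<open>S\<close> and \<open>T\<close>
  non-isomorphic this forces \<open>\<theta> = 0\<close> and \<open>h = \<theta>\<^sup>* = 0\<close>, in both directions, which is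
  orthogonality.  For \<open>S = T\<close> a nonzero \<open>h\<close> is \<open>\<theta>\<^sup>*\<close> with \<open>\<theta>\<close> invertible, and functoriality makes
  \<open>(\<theta>\<^sup>-\<^sup>1)\<^sup>*\<close> an inverse of \<open>h\<close>; so \<open>End(S\<^sup>*)\<close> is a division ring.  It is not the zero ring, because
  \<open>S\<close> is nonzero and its points are separated by \<open>S\<^sup>*\<close>.

  A brick also has to have finite length.  A simple module is generated by one element \<open>x\<close>, so
  \<open>f \<mapsto> f(x)\<close> embeds \<open>S\<^sup>*\<close> into \<open>A\<^sub>A\<close>; and right ideals are subspaces of the finite-dimensional
  space \<open>A\<close>, so their strict chains are bounded (\<open>finite_length_right_regular\<close>).
\<close>

section \<open>Groups with operators\<close>

text \<open>
  Homomorphisms, submodules and endomorphism rings do not see in which order scalars compose.  What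
  left and right modules share is an abelian group on which the elements of \<open>A\<close> act by additive
  maps; working at this level treats modules and their duals uniformly.
\<close>

locale operator_group = abelian_group M
  for A :: "('a, 'm) ring_scheme" and M :: "('a, 'b, 'n) module_scheme" (structure) +
  assumes op_closed: "\<lbrakk>a \<in> carrier A; x \<in> carrier M\<rbrakk> \<Longrightarrow> a \<odot> x \<in> carrier M"
    and op_add:
      "\<lbrakk>a \<in> carrier A; x \<in> carrier M; y \<in> carrier M\<rbrakk> \<Longrightarrow> a \<odot> (x \<oplus> y) = a \<odot> x \<oplus> a \<odot> y"

lemma (in operator_group) op_zero: "a \<in> carrier A \<Longrightarrow> a \<odot> \<zero> = \<zero>"
  using op_add[of a \<zero> \<zero>] op_closed[of a \<zero>] by (metis add.l_cancel_one' l_zero zero_closed)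

lemma left_module_operator_group: "left_module A M \<Longrightarrow> operator_group A M"
  by (simp add: left_module_def left_module_axioms_def operator_group_def operator_group_axioms_def)

lemma right_module_operator_group: "right_module A M \<Longrightarrow> operator_group A M"
  by (simp add: right_module_def right_module_axioms_def operator_group_def operator_group_axioms_def)

lemma HomI:
  assumes "\<And>x. x \<in> carrier M \<Longrightarrow> f x \<in> carrier N"
    and "\<And>x y. \<lbrakk>x \<in> carrier M; y \<in> carrier M\<rbrakk> \<Longrightarrow> f (x \<oplus>\<^bsub>M\<^esub> y) = f x \<oplus>\<^bsub>N\<^esub> f y"
    and "\<And>a x. \<lbrakk>a \<in> carrier A; x \<in> carrier M\<rbrakk> \<Longrightarrow> f (a \<odot>\<^bsub>M\<^esub> x) = a \<odot>\<^bsub>N\<^esub> f x"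
    and "f \<in> extensional (carrier M)"
  shows "f \<in> Hom A M N"
  using assms by (auto simp: Hom_def LinearCombinations.module_hom_def)

lemma Hom_closed: "\<lbrakk>f \<in> Hom A M N; x \<in> carrier M\<rbrakk> \<Longrightarrow> f x \<in> carrier N"
  by (auto simp: Hom_def LinearCombinations.module_hom_def)

lemma Hom_add:
  "\<lbrakk>f \<in> Hom A M N; x \<in> carrier M; y \<in> carrier M\<rbrakk> \<Longrightarrow> f (x \<oplus>\<^bsub>M\<^esub> y) = f x \<oplus>\<^bsub>N\<^esub> f y"
  by (auto simp: Hom_def LinearCombinations.module_hom_def)

lemma Hom_smult:
  "\<lbrakk>f \<in> Hom A M N; a \<in> carrier A; x \<in> carrier M\<rbrakk> \<Longrightarrow> f (a \<odot>\<^bsub>M\<^esub> x) = a \<odot>\<^bsub>N\<^esub> f x"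
  by (auto simp: Hom_def LinearCombinations.module_hom_def)

lemma Hom_extensional: "f \<in> Hom A M N \<Longrightarrow> f \<in> extensional (carrier M)"
  by (simp add: Hom_def)

lemma Hom_eqI:
  assumes "f \<in> Hom A M N" "g \<in> Hom A M N" "\<And>x. x \<in> carrier M \<Longrightarrow> f x = g x"
  shows "f = g"
  using assms by (meson Hom_extensional extensionalityI)

lemma Hom_abelian_group_hom:
  assumes "abelian_group M" "abelian_group N" "f \<in> Hom A M N"
  shows "abelian_group_hom M N f"
proof (rule abelian_group_homI[OF assms(1,2)])
  show "group_hom (add_monoid M) (add_monoid N) f"
    using assms Hom_closed[OF assms(3)] Hom_add[OF assms(3)]
    by (auto simp: group_hom_def group_hom_axioms_def hom_def abelian_group.a_group)
qed

lemma Hom_zero: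
  assumes "abelian_group M" "abelian_group N" "f \<in> Hom A M N"
  shows "f \<zero>\<^bsub>M\<^esub> = \<zero>\<^bsub>N\<^esub>"
  by (rule abelian_group_hom.hom_zero[OF Hom_abelian_group_hom[OF assms]])

lemma Hom_a_inv:
  assumes "abelian_group M" "abelian_group N" "f \<in> Hom A M N" "x \<in> carrier M"
  shows "f (\<ominus>\<^bsub>M\<^esub> x) = \<ominus>\<^bsub>N\<^esub> f x"
  by (rule abelian_group_hom.hom_a_inv[OF Hom_abelian_group_hom[OF assms(1-3)] assms(4)])

lemma Hom_inj_onI:
  assumes "abelian_group M" "abelian_group N" "f \<in> Hom A M N"
    and "\<And>x. \<lbrakk>x \<in> carrier M; f x = \<zero>\<^bsub>N\<^esub>\<rbrakk> \<Longrightarrow> x = \<zero>\<^bsub>M\<^esub>"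
  shows "inj_on f (carrier M)"
proof (rule inj_onI)
  interpret M: abelian_group M by (rule assms(1))
  interpret N: abelian_group N by (rule assms(2))
  fix x y assume xy: "x \<in> carrier M" "y \<in> carrier M" "f x = f y"
  have "f (x \<oplus>\<^bsub>M\<^esub> \<ominus>\<^bsub>M\<^esub> y) = \<zero>\<^bsub>N\<^esub>"
    using xy assms Hom_closed[OF assms(3)] by (simp add: Hom_add[OF assms(3)] Hom_a_inv N.r_neg)
  then have "x \<oplus>\<^bsub>M\<^esub> \<ominus>\<^bsub>M\<^esub> y = \<zero>\<^bsub>M\<^esub>"
    using assms(4) xy by simp
  then show "x = y"
    using xy M.minus_equality M.minus_minus M.a_inv_closed by metis
qed

lemma Hom_compose:
  assumes "f \<in> Hom A L M" "g \<in> Hom A M N" "operator_group A L"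
  shows "compose (carrier L) g f \<in> Hom A L N"
proof -
  interpret L: operator_group A L by fact
  show ?thesis
    by (rule HomI) (auto simp: compose_def L.op_closed Hom_closed[OF assms(1)] Hom_closed[OF assms(2)]
      Hom_add[OF assms(1)] Hom_add[OF assms(2)] Hom_smult[OF assms(1)] Hom_smult[OF assms(2)])
qed

lemma Hom_inverse:
  assumes "f \<in> Hom A M N" "bij_betw f (carrier M) (carrier N)" "operator_group A M" "operator_group A N"
  shows "(\<lambda>y\<in>carrier N. inv_into (carrier M) f y) \<in> Hom A N M"
proof -
  interpret M: operator_group A M by fact
  interpret N: operator_group A N by fact
  let ?g = "inv_into (carrier M) f"
  have g: "?g y \<in> carrier M" "f (?g y) = y" if "y \<in> carrier N" for y
    using that assms(2) by (auto simp: bij_betw_def inv_into_into f_inv_into_f)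
  have gf: "?g (f x) = x" if "x \<in> carrier M" for x
    using that assms(2) by (simp add: bij_betw_def)
  show ?thesis
  proof (rule HomI)
    fix x y assume xy: "x \<in> carrier N" "y \<in> carrier N"
    have "?g (x \<oplus>\<^bsub>N\<^esub> y) = ?g (f (?g x \<oplus>\<^bsub>M\<^esub> ?g y))"
      using xy g by (simp add: Hom_add[OF assms(1)])
    then show "(\<lambda>y\<in>carrier N. ?g y) (x \<oplus>\<^bsub>N\<^esub> y)
        = (\<lambda>y\<in>carrier N. ?g y) x \<oplus>\<^bsub>M\<^esub> (\<lambda>y\<in>carrier N. ?g y) y"
      using xy g gf by simp
  next
    fix a x assume ax: "a \<in> carrier A" "x \<in> carrier N"
    have "?g (a \<odot>\<^bsub>N\<^esub> x) = ?g (f (a \<odot>\<^bsub>M\<^esub> ?g x))"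
      using ax g by (simp add: Hom_smult[OF assms(1)])
    then show "(\<lambda>y\<in>carrier N. ?g y) (a \<odot>\<^bsub>N\<^esub> x) = a \<odot>\<^bsub>M\<^esub> (\<lambda>y\<in>carrier N. ?g y) x"
      using ax g gf by (simp add: M.op_closed N.op_closed)
  qed (use g in auto)
qed

lemma (in operator_group) submoduleI:
  assumes "H \<subseteq> carrier M" "\<zero> \<in> H"
    and "\<And>x y. \<lbrakk>x \<in> H; y \<in> H\<rbrakk> \<Longrightarrow> x \<oplus> y \<in> H" and "\<And>x. x \<in> H \<Longrightarrow> \<ominus> x \<in> H"
    and "\<And>a x. \<lbrakk>a \<in> carrier A; x \<in> H\<rbrakk> \<Longrightarrow> a \<odot> x \<in> H"
  shows "Module.submodule H A M"
  using assms
  by (auto simp: Module.submodule_def submodule_axioms_def subgroup_def a_inv_def)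

lemma submoduleD:
  assumes "Module.submodule H A M"
  shows "H \<subseteq> carrier M" "\<zero>\<^bsub>M\<^esub> \<in> H"
    and "\<lbrakk>x \<in> H; y \<in> H\<rbrakk> \<Longrightarrow> x \<oplus>\<^bsub>M\<^esub> y \<in> H" and "x \<in> H \<Longrightarrow> \<ominus>\<^bsub>M\<^esub> x \<in> H"
    and "\<lbrakk>a \<in> carrier A; x \<in> H\<rbrakk> \<Longrightarrow> a \<odot>\<^bsub>M\<^esub> x \<in> H"
  using assms
  by (auto simp: Module.submodule_def submodule_axioms_def subgroup_def a_inv_def)

lemma Hom_image_submodule:
  assumes "f \<in> Hom A M N" "operator_group A M" "operator_group A N" "Module.submodule H A M"
  shows "Module.submodule (f ` H) A N"
proof -
  interpret M: operator_group A M by fact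
  interpret N: operator_group A N by fact
  note H = submoduleD[OF assms(4)]
  have sub: "x \<in> carrier M" if "x \<in> H" for x using H(1) that by blast
  show ?thesis
  proof (rule N.submoduleI)
    show "f ` H \<subseteq> carrier N" using sub Hom_closed[OF assms(1)] by blast
    show "\<zero>\<^bsub>N\<^esub> \<in> f ` H"
      using Hom_zero[OF M.abelian_group_axioms N.abelian_group_axioms assms(1)] H(2) by (metis imageI)
    show "x \<oplus>\<^bsub>N\<^esub> y \<in> f ` H" if "x \<in> f ` H" "y \<in> f ` H" for x y
      using that H(3) sub Hom_add[OF assms(1)] by (auto simp: image_iff) metis
    show "\<ominus>\<^bsub>N\<^esub> x \<in> f ` H" if "x \<in> f ` H" for x
      using that H(4) sub Hom_a_inv[OF M.abelian_group_axioms N.abelian_group_axioms assms(1)]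
      by (auto simp: image_iff) metis
    show "a \<odot>\<^bsub>N\<^esub> x \<in> f ` H" if "a \<in> carrier A" "x \<in> f ` H" for a x
      using that H(5) sub Hom_smult[OF assms(1)] by (auto simp: image_iff) metis
  qed
qed

lemma Hom_kernel_submodule:
  assumes "f \<in> Hom A M N" "operator_group A M" "operator_group A N"
  shows "Module.submodule {x \<in> carrier M. f x = \<zero>\<^bsub>N\<^esub>} A M"
proof -
  interpret M: operator_group A M by fact
  interpret N: operator_group A N by fact
  show ?thesis
    using Hom_zero[OF M.abelian_group_axioms N.abelian_group_axioms assms(1)]
      Hom_a_inv[OF M.abelian_group_axioms N.abelian_group_axioms assms(1)]
    by (intro M.submoduleI)
      (auto simp: Hom_add[OF assms(1)] Hom_smult[OF assms(1)] M.op_closed N.op_zero)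
qed

lemma (in operator_group) zero_Hom:
  assumes "operator_group A L"
  shows "(\<lambda>x\<in>carrier L. \<zero>) \<in> Hom A L M"
proof -
  interpret L: operator_group A L by fact
  show ?thesis by (rule HomI) (auto simp: op_zero L.op_closed)
qed

text \<open>
  Taking images along an injective homomorphism turns a strict chain of submodules into a strict
  chain of the same length.
\<close>

lemma finite_length_inj_Hom:
  assumes "f \<in> Hom A M N" "operator_group A M" "operator_group A N" "inj_on f (carrier M)"
    and "finite_length A N"
  shows "finite_length A M"
proof -
  obtain n where n: "\<And>Ns. \<lbrakk>\<forall>N'\<in>set Ns. Module.submodule N' A N; sorted_wrt (\<subset>) Ns\<rbrakk> \<Longrightarrow> length Ns \<le> n"
    using assms(5) unfolding finite_length_def by blast
  have "length Ms \<le> n" if Ms: "\<forall>M'\<in>set Ms. Module.submodule M' A M" "sorted_wrt (\<subset>) Ms" for Ms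
  proof -
    have "sorted_wrt (\<subset>) (map ((`) f) Ms)"
      unfolding sorted_wrt_map
    proof (rule sorted_wrt_mono_rel[OF _ Ms(2)])
      fix P Q assume PQ: "P \<in> set Ms" "Q \<in> set Ms" "P \<subset> Q"
      then have "P \<subseteq> carrier M" "Q \<subseteq> carrier M" using Ms(1) submoduleD(1) by blast+
      then show "f ` P \<subset> f ` Q"
        using PQ(3) inj_on_image_eq_iff[OF assms(4), of P Q] by blast
    qed
    moreover have "\<forall>N'\<in>set (map ((`) f) Ms). Module.submodule N' A N"
      using Ms(1) Hom_image_submodule[OF assms(1-3)] by auto
    ultimately show ?thesis using n[of "map ((`) f) Ms"] by simp
  qed
  then show ?thesis unfolding finite_length_def by blast
qed

lemma End_ring_simps [simp]:
  "carrier (End_ring A M) = Hom A M M"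
  "f \<otimes>\<^bsub>End_ring A M\<^esub> g = compose (carrier M) f g"
  "\<one>\<^bsub>End_ring A M\<^esub> = (\<lambda>x\<in>carrier M. x)"
  "\<zero>\<^bsub>End_ring A M\<^esub> = (\<lambda>x\<in>carrier M. \<zero>\<^bsub>M\<^esub>)"
  "f \<oplus>\<^bsub>End_ring A M\<^esub> g = (\<lambda>x\<in>carrier M. f x \<oplus>\<^bsub>M\<^esub> g x)"
  by (simp_all add: End_ring_def)

lemma (in operator_group) id_Hom: "(\<lambda>x\<in>carrier M. x) \<in> Hom A M M"
  by (rule HomI) (auto simp: op_closed)

lemma (in operator_group) Hom_pointwise_add:
  assumes "f \<in> Hom A L M" "g \<in> Hom A L M" "operator_group A L"
  shows "(\<lambda>x\<in>carrier L. f x \<oplus> g x) \<in> Hom A L M"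
proof -
  interpret L: operator_group A L by fact
  show ?thesis
    by (rule HomI) (auto simp: L.op_closed Hom_closed[OF assms(1)] Hom_closed[OF assms(2)]
      Hom_add[OF assms(1)] Hom_add[OF assms(2)] Hom_smult[OF assms(1)] Hom_smult[OF assms(2)]
      op_add a_ac)
qed

lemma (in operator_group) a_inv_Hom: "(\<lambda>x\<in>carrier M. \<ominus> x) \<in> Hom A M M"
proof (rule HomI)
  show "(\<lambda>x\<in>carrier M. \<ominus> x) (a \<odot> x) = a \<odot> (\<lambda>x\<in>carrier M. \<ominus> x) x"
    if "a \<in> carrier A" "x \<in> carrier M" for a x
  proof -
    have "a \<odot> (\<ominus> x) \<oplus> a \<odot> x = \<zero>"
      using that by (simp add: op_add[symmetric] l_neg op_zero)
    then have "\<ominus> (a \<odot> x) = a \<odot> (\<ominus> x)"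
      using that by (intro minus_equality) (auto simp: op_closed)
    then show ?thesis using that by (simp add: op_closed)
  qed
qed (auto simp: minus_add)

lemma (in operator_group) End_ring_is_ring: "ring (End_ring A M)"
proof (rule ringI)
  note og = operator_group_axioms
  show "abelian_group (End_ring A M)"
  proof (rule abelian_groupI, goal_cases)
    case (6 f)
    then have "compose (carrier M) (\<lambda>x\<in>carrier M. \<ominus> x) f \<in> Hom A M M"
      using Hom_compose[OF _ a_inv_Hom og] by simp
    moreover have "(\<lambda>x\<in>carrier M. compose (carrier M) (\<lambda>x\<in>carrier M. \<ominus> x) f x \<oplus> f x)
        = (\<lambda>x\<in>carrier M. \<zero>)"
      using 6 by (auto simp: compose_def Hom_closed l_neg restrict_def fun_eq_iff)
    ultimately show ?case by auto
  qed (auto simp: Hom_pointwise_add og zero_Hom Hom_closed a_ac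
      intro!: restrict_ext extensionalityI[OF restrict_extensional Hom_extensional])
  show "monoid (End_ring A M)"
  proof (rule monoidI, goal_cases)
    case (1 f g)
    then show ?case using Hom_compose[OF _ _ og] by simp
  next
    case (3 f g h)
    then show ?case by (auto simp: compose_def Hom_closed intro!: restrict_ext)
  next
    case (4 f)
    then show ?case
      by (auto simp: compose_def Hom_closed
        intro!: extensionalityI[OF restrict_extensional Hom_extensional])
  next
    case (5 f)
    then show ?case
      by (auto simp: compose_def intro!: extensionalityI[OF restrict_extensional Hom_extensional])
  qed (simp add: id_Hom)
qed (auto simp: compose_def Hom_closed Hom_add intro!: restrict_ext)

section \<open>Schur's lemma\<close>

text \<open>
  Since \<open>f\<close> is not zero, its kernel is a proper submodule of \<open>S\<close> and its image a nonzero submodule of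
  \<open>T\<close>.
\<close>

lemma Schur:
  assumes "simple_left_module A S" "simple_left_module A T" "f \<in> Hom A S T"
    and "f \<noteq> (\<lambda>x\<in>carrier S. \<zero>\<^bsub>T\<^esub>)"
  shows "bij_betw f (carrier S) (carrier T)"
proof -
  interpret S: operator_group A S
    using assms(1) left_module_operator_group by (auto simp: simple_left_module_def)
  interpret T: operator_group A T
    using assms(2) left_module_operator_group by (auto simp: simple_left_module_def)
  note SA = S.operator_group_axioms and TA = T.operator_group_axioms
  obtain x where x: "x \<in> carrier S" "f x \<noteq> \<zero>\<^bsub>T\<^esub>"
    using assms(4) Hom_extensional[OF assms(3)] by (metis extensionalityI restrict_apply' restrict_extensional)
  have "Module.submodule {x \<in> carrier S. f x = \<zero>\<^bsub>T\<^esub>} A S"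
    by (rule Hom_kernel_submodule[OF assms(3) SA TA])
  then have ker: "{x \<in> carrier S. f x = \<zero>\<^bsub>T\<^esub>} = {\<zero>\<^bsub>S\<^esub>}"
    using assms(1) x unfolding simple_left_module_def by blast
  have "Module.submodule (carrier S) A S"
    by (rule S.submoduleI) (auto simp: S.op_closed)
  then have "Module.submodule (f ` carrier S) A T"
    by (rule Hom_image_submodule[OF assms(3) SA TA])
  then have "f ` carrier S = carrier T"
    using assms(2) x unfolding simple_left_module_def by blast
  moreover have "inj_on f (carrier S)"
    using ker by (intro Hom_inj_onI[OF S.abelian_group_axioms T.abelian_group_axioms assms(3)]) auto
  ultimately show ?thesis by (simp add: bij_betw_def)
qed

section \<open>Dual modules\<close>

lemma left_regular_simps [simp]:
  "carrier (left_regular A) = carrier A" "\<zero>\<^bsub>left_regular A\<^esub> = \<zero>\<^bsub>A\<^esub>"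
  "x \<oplus>\<^bsub>left_regular A\<^esub> y = x \<oplus>\<^bsub>A\<^esub> y" "a \<odot>\<^bsub>left_regular A\<^esub> x = a \<otimes>\<^bsub>A\<^esub> x"
  by (simp_all add: left_regular_def)

lemma right_regular_simps [simp]:
  "carrier (right_regular A) = carrier A" "\<zero>\<^bsub>right_regular A\<^esub> = \<zero>\<^bsub>A\<^esub>"
  "x \<oplus>\<^bsub>right_regular A\<^esub> y = x \<oplus>\<^bsub>A\<^esub> y" "a \<odot>\<^bsub>right_regular A\<^esub> x = x \<otimes>\<^bsub>A\<^esub> a"
  by (simp_all add: right_regular_def)

lemma dual_of_left_simps [simp]:
  "carrier (dual_of_left A M) = Hom A M (left_regular A)"
  "\<zero>\<^bsub>dual_of_left A M\<^esub> = (\<lambda>m\<in>carrier M. \<zero>\<^bsub>A\<^esub>)"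
  "f \<oplus>\<^bsub>dual_of_left A M\<^esub> g = (\<lambda>m\<in>carrier M. f m \<oplus>\<^bsub>A\<^esub> g m)"
  "a \<odot>\<^bsub>dual_of_left A M\<^esub> f = (\<lambda>m\<in>carrier M. f m \<otimes>\<^bsub>A\<^esub> a)"
  by (simp_all add: dual_of_left_def)

lemma carrier_dual_of_right [simp]: "carrier (dual_of_right A N) = Hom A N (right_regular A)"
  by (simp add: dual_of_right_def)

lemma (in ring) left_module_left_regular: "left_module R (left_regular R)"
proof -
  have "abelian_group (left_regular R)"
    by (rule abelian_groupI) (auto simp: a_ac intro: bexI[of _ "\<ominus> x" for x] l_neg)
  then show ?thesis
    by (auto simp: left_module_def left_module_axioms_def ring_axioms l_distr r_distr m_assoc)
qed

lemma (in ring) right_module_right_regular: "right_module R (right_regular R)"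
proof -
  have "abelian_group (right_regular R)"
    by (rule abelian_groupI) (auto simp: a_ac intro: bexI[of _ "\<ominus> x" for x] l_neg)
  then show ?thesis
    by (auto simp: right_module_def right_module_axioms_def ring_axioms l_distr r_distr m_assoc)
qed

lemma dual_Hom_apply:
  assumes "f \<in> Hom A M (left_regular A)"
  shows "x \<in> carrier M \<Longrightarrow> f x \<in> carrier A"
    and "\<lbrakk>x \<in> carrier M; y \<in> carrier M\<rbrakk> \<Longrightarrow> f (x \<oplus>\<^bsub>M\<^esub> y) = f x \<oplus>\<^bsub>A\<^esub> f y"
    and "\<lbrakk>a \<in> carrier A; x \<in> carrier M\<rbrakk> \<Longrightarrow> f (a \<odot>\<^bsub>M\<^esub> x) = a \<otimes>\<^bsub>A\<^esub> f x"
  using Hom_closed[OF assms] Hom_add[OF assms] Hom_smult[OF assms] by simp_all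

text \<open>
  The values of a functional are multiplied on the right, and this commutes with the left linearity
  that makes it a functional.
\<close>

lemma right_module_dual_of_left:
  assumes "left_module A M"
  shows "right_module A (dual_of_left A M)"
proof -
  interpret left_module A M by fact
  note og = left_module_operator_group[OF assms]
  interpret L: operator_group A "left_regular A"
    by (rule left_module_operator_group[OF R.left_module_left_regular])
  have add: "(\<lambda>x\<in>carrier M. f x \<oplus>\<^bsub>A\<^esub> g x) \<in> Hom A M (left_regular A)"
    if "f \<in> Hom A M (left_regular A)" "g \<in> Hom A M (left_regular A)" for f g
    using L.Hom_pointwise_add[OF that og] by simp
  have zero: "(\<lambda>x\<in>carrier M. \<zero>\<^bsub>A\<^esub>) \<in> Hom A M (left_regular A)"
    using L.zero_Hom[OF og] by simp
  have neg: "(\<lambda>x\<in>carrier M. \<ominus>\<^bsub>A\<^esub> f x) \<in> Hom A M (left_regular A)"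
    if "f \<in> Hom A M (left_regular A)" for f
    by (rule HomI) (auto simp: dual_Hom_apply[OF that] smult_closed R.minus_add R.r_minus)
  have smult: "(\<lambda>x\<in>carrier M. f x \<otimes>\<^bsub>A\<^esub> a) \<in> Hom A M (left_regular A)"
    if "f \<in> Hom A M (left_regular A)" "a \<in> carrier A" for f a
    by (rule HomI) (auto simp: dual_Hom_apply[OF that(1)] that(2) smult_closed R.l_distr R.m_assoc)
  have "abelian_group (dual_of_left A M)"
  proof (rule abelian_groupI, goal_cases)
    case (6 f)
    then have f: "f \<in> Hom A M (left_regular A)" by simp
    show ?case
      using neg[OF f] dual_Hom_apply(1)[OF f]
      by (intro bexI[of _ "\<lambda>x\<in>carrier M. \<ominus>\<^bsub>A\<^esub> f x"]) (auto simp: R.l_neg intro!: restrict_ext)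
  qed (auto simp: add zero dual_Hom_apply(1) R.a_ac
      intro!: restrict_ext extensionalityI[OF restrict_extensional Hom_extensional])
  then show ?thesis
    unfolding right_module_def right_module_axioms_def
    by (auto simp: R.ring_axioms smult dual_Hom_apply(1) R.l_distr R.r_distr R.m_assoc
      intro!: restrict_ext extensionalityI[OF restrict_extensional Hom_extensional])
qed

text \<open>
  The closure properties of the dual module, in the form to which the simplifier reduces its
  operations.
\<close>

lemma dual_of_left_closed:
  assumes "left_module A M" "f \<in> Hom A M (left_regular A)"
  shows "g \<in> Hom A M (left_regular A) \<Longrightarrow> (\<lambda>m\<in>carrier M. f m \<oplus>\<^bsub>A\<^esub> g m) \<in> Hom A M (left_regular A)"
    and "a \<in> carrier A \<Longrightarrow> (\<lambda>m\<in>carrier M. f m \<otimes>\<^bsub>A\<^esub> a) \<in> Hom A M (left_regular A)"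
proof -
  interpret D: right_module A "dual_of_left A M"
    by (rule right_module_dual_of_left) (rule assms(1))
  show "g \<in> Hom A M (left_regular A) \<Longrightarrow> (\<lambda>m\<in>carrier M. f m \<oplus>\<^bsub>A\<^esub> g m) \<in> Hom A M (left_regular A)"
    using D.M.a_closed[of f g] assms(2) by simp
  show "a \<in> carrier A \<Longrightarrow> (\<lambda>m\<in>carrier M. f m \<otimes>\<^bsub>A\<^esub> a) \<in> Hom A M (left_regular A)"
    using D.smult_closed[of a f] assms(2) by simp
qed

section \<open>Homomorphisms between duals\<close>

definition dual_map ::
  "('a, 'm) ring_scheme \<Rightarrow> ('a, 'b, 'n) module_scheme \<Rightarrow> ('a, 'c, 'p) module_scheme \<Rightarrow>
    ('b \<Rightarrow> 'c) \<Rightarrow> ('c \<Rightarrow> 'a) \<Rightarrow> ('b \<Rightarrow> 'a)"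
  where "dual_map A M N \<theta> = (\<lambda>f\<in>carrier (dual_of_left A N). compose (carrier M) f \<theta>)"

lemma dual_map_Hom:
  assumes "left_module A M" "left_module A N" "\<theta> \<in> Hom A M N"
  shows "dual_map A M N \<theta> \<in> Hom A (dual_of_left A N) (dual_of_left A M)"
proof -
  have comp: "compose (carrier M) f \<theta> \<in> Hom A M (left_regular A)"
    if "f \<in> Hom A N (left_regular A)" for f
    by (rule Hom_compose[OF assms(3) that left_module_operator_group[OF assms(1)]])
  show ?thesis
    using comp dual_of_left_closed[OF assms(2)] Hom_closed[OF assms(3)]
    by (intro HomI) (auto simp: dual_map_def compose_def intro!: restrict_ext)
qed

lemma dual_map_compose:
  assumes "operator_group A L" "\<rho> \<in> Hom A L M" "\<theta> \<in> Hom A M N" "operator_group A M"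
  shows "compose (carrier (dual_of_left A N)) (dual_map A L M \<rho>) (dual_map A M N \<theta>)
    = dual_map A L N (compose (carrier L) \<theta> \<rho>)"
proof -
  have "compose (carrier M) f \<theta> \<in> Hom A M (left_regular A)" if "f \<in> Hom A N (left_regular A)" for f
    by (rule Hom_compose[OF assms(3) that assms(4)])
  then show ?thesis
    using Hom_closed[OF assms(2)] by (auto simp: dual_map_def compose_def intro!: restrict_ext)
qed

lemma dual_map_id: "dual_map A M M (\<lambda>x\<in>carrier M. x) = (\<lambda>f\<in>carrier (dual_of_left A M). f)"
  unfolding dual_map_def
  by (rule restrict_ext) (auto simp: compose_def intro!: extensionalityI[OF restrict_extensional Hom_extensional])

lemma dual_map_zero:
  assumes "abelian_group M" "abelian_group N" "ring A"
  shows "dual_map A M N (\<lambda>x\<in>carrier M. \<zero>\<^bsub>N\<^esub>) = (\<lambda>f\<in>carrier (dual_of_left A N). \<zero>\<^bsub>dual_of_left A M\<^esub>)"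
proof -
  interpret L: operator_group A "left_regular A"
    by (rule left_module_operator_group[OF ring.left_module_left_regular[OF assms(3)]])
  show ?thesis
    using Hom_zero[OF assms(2) L.abelian_group_axioms, of _ A] 
    by (auto simp: dual_map_def compose_def intro!: restrict_ext)
qed

text \<open>
  This is the injectivity of the evaluation map: identities in a reflexive module can be checked
  after applying an arbitrary functional.
\<close>

lemma reflexive_separates:
  assumes "reflexive_left_module A T" "t \<in> carrier T" "t' \<in> carrier T"
    and "\<And>f. f \<in> Hom A T (left_regular A) \<Longrightarrow> f t = f t'"
  shows "t = t'"
proof -
  have "evaluation A T t = evaluation A T t'"
    using assms(4) by (auto simp: evaluation_def intro!: restrict_ext)
  then show ?thesis
    using assms(1-3) by (auto simp: reflexive_left_module_def bij_betw_def inj_on_def)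
qed

text \<open>
  Surjectivity of the evaluation map of \<open>T\<close> yields the point \<open>\<theta>(s)\<close> at which the functional
  \<open>f \<mapsto> h(f)(s)\<close> on \<open>T\<^sup>*\<close> evaluates; injectivity makes \<open>\<theta>\<close> linear, since
  \<open>f(\<theta>(s)) = h(f)(s)\<close> is linear in \<open>s\<close> for every \<open>f\<close>.
\<close>

lemma Hom_between_duals_is_dual_map:
  assumes "left_module A S" "reflexive_left_module A T"
    and h: "h \<in> Hom A (dual_of_left A T) (dual_of_left A S)"
  obtains \<theta> where "\<theta> \<in> Hom A S T" "h = dual_map A S T \<theta>"
proof -
  interpret S: left_module A S by fact
  interpret T: left_module A T using assms(2) by (simp add: reflexive_left_module_def)
  let ?D = "Hom A T (left_regular A)"
  have hf: "h f \<in> Hom A S (left_regular A)" if "f \<in> ?D" for f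
    using Hom_closed[OF h] that by simp
  \<comment> \<open>The element of the bidual of \<open>T\<close> that \<open>h\<close> attaches to a point of \<open>S\<close>.\<close>
  have g: "(\<lambda>f\<in>?D. h f s) \<in> Hom A (dual_of_left A T) (right_regular A)" if s: "s \<in> carrier S" for s
    using s dual_of_left_closed[OF T.left_module_axioms] Hom_add[OF h] Hom_smult[OF h] dual_Hom_apply(1)[OF hf]
    by (intro HomI) auto
  have "\<exists>t\<in>carrier T. \<forall>f\<in>?D. h f s = f t" if s: "s \<in> carrier S" for s
  proof -
    obtain t where t: "t \<in> carrier T" "evaluation A T t = (\<lambda>f\<in>?D. h f s)"
      using assms(2) g[OF s] unfolding reflexive_left_module_def bij_betw_def
      by (metis carrier_dual_of_right imageE)
    then have "h f s = f t" if "f \<in> ?D" for f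
      using that t(2) unfolding evaluation_def by (metis dual_of_left_simps(1) restrict_apply')
    with t(1) show ?thesis by blast
  qed
  then obtain \<theta>' where \<theta>': "\<And>s. s \<in> carrier S \<Longrightarrow> \<theta>' s \<in> carrier T"
      "\<And>s f. \<lbrakk>s \<in> carrier S; f \<in> ?D\<rbrakk> \<Longrightarrow> h f s = f (\<theta>' s)"
    by metis
  define \<theta> where "\<theta> = restrict \<theta>' (carrier S)"
  have \<theta>: "\<theta> s \<in> carrier T" "f \<in> ?D \<Longrightarrow> f (\<theta> s) = h f s" if "s \<in> carrier S" for s f
    using \<theta>' that by (simp_all add: \<theta>_def)
  have "\<theta> \<in> Hom A S T"
  proof (rule HomI)
    fix x y assume xy: "x \<in> carrier S" "y \<in> carrier S"
    show "\<theta> (x \<oplus>\<^bsub>S\<^esub> y) = \<theta> x \<oplus>\<^bsub>T\<^esub> \<theta> y"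
    proof (rule reflexive_separates[OF assms(2)])
      fix f assume f: "f \<in> ?D"
      show "f (\<theta> (x \<oplus>\<^bsub>S\<^esub> y)) = f (\<theta> x \<oplus>\<^bsub>T\<^esub> \<theta> y)"
        using xy \<theta>(1) \<theta>(2)[OF _ f]
        by (simp add: dual_Hom_apply(2)[OF f] dual_Hom_apply(2)[OF hf[OF f]])
    qed (use xy \<theta>(1) in auto)
  next
    fix a x assume ax: "a \<in> carrier A" "x \<in> carrier S"
    show "\<theta> (a \<odot>\<^bsub>S\<^esub> x) = a \<odot>\<^bsub>T\<^esub> \<theta> x"
    proof (rule reflexive_separates[OF assms(2)])
      fix f assume f: "f \<in> ?D"
      show "f (\<theta> (a \<odot>\<^bsub>S\<^esub> x)) = f (a \<odot>\<^bsub>T\<^esub> \<theta> x)"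
        using ax \<theta>(1) \<theta>(2)[OF _ f] S.smult_closed
        by (simp add: dual_Hom_apply(3)[OF f] dual_Hom_apply(3)[OF hf[OF f]])
    qed (use ax \<theta>(1) S.smult_closed T.smult_closed in auto)
  qed (use \<theta> in \<open>auto simp: \<theta>_def\<close>)
  moreover have "h = dual_map A S T \<theta>"
  proof (rule extensionalityI[OF Hom_extensional[OF h]])
    show "dual_map A S T \<theta> \<in> extensional (carrier (dual_of_left A T))"
      by (simp add: dual_map_def)
    fix f assume "f \<in> carrier (dual_of_left A T)"
    then have f: "f \<in> ?D" by simp
    have "h f = compose (carrier S) f \<theta>"
      by (rule extensionalityI[OF Hom_extensional[OF hf[OF f]]]) (auto simp: compose_def \<theta> f)
    then show "h f = dual_map A S T \<theta> f" using f by (simp add: dual_map_def)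
  qed
  ultimately show ?thesis using that by blast
qed

section \<open>Finite length\<close>

text \<open>
  Picking a vector outside the preceding subspace at each step of the chain produces an independent
  set.  The first subspace may be zero and contributes no vector, whence the successor.
\<close>

lemma (in vectorspace) subspace_chain_length:
  assumes "fin_dim" "\<forall>W \<in> set Ws. VectorSpace.subspace K W V" "sorted_wrt (\<subset>) Ws"
  shows "length Ws \<le> Suc dim"
proof -
  have "\<exists>B. B \<subseteq> last Ws \<and> finite B \<and> lin_indpt B \<and> Suc (card B) = length Ws"
    if "Ws \<noteq> []" "\<forall>W \<in> set Ws. VectorSpace.subspace K W V" "sorted_wrt (\<subset>) Ws" for Ws
    using that
  proof (induction Ws rule: rev_nonempty_induct)
    case (single W)
    have "lin_indpt {}" by (simp add: lin_dep_def)
    then show ?case by (intro exI[of _ "{}"]) simp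
  next
    case (snoc W Ws)
    then obtain B where B: "B \<subseteq> last Ws" "finite B" "lin_indpt B" "Suc (card B) = length Ws"
      by (auto simp: sorted_wrt_append)
    have "last Ws \<subset> W"
      using snoc.prems(2) snoc.hyps by (simp add: sorted_wrt_append)
    then obtain v where v: "v \<in> W" "v \<notin> last Ws" by blast
    have sub: "LinearCombinations.submodule K (last Ws) V" "LinearCombinations.submodule K W V"
      using snoc.prems(1) snoc.hyps by (auto intro: is_module)
    then have car: "B \<subseteq> carrier V" "v \<in> carrier V"
      using B(1) v(1) by (auto dest: LinearCombinations.submodule.subset)
    have "v \<notin> span B"
      using span_is_subset[OF B(1) sub(1)] v(2) by blast
    then have "lin_indpt (B \<union> {v})"
      using lin_dep_iff_in_span[OF car(1) B(3) car(2)] B(1) v(2) by blast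
    then show ?case
      using B v \<open>last Ws \<subset> W\<close> by (intro exI[of _ "B \<union> {v}"]) (auto simp: card_insert_if)
  qed
  note independent = this
  show ?thesis
  proof (cases "Ws = []")
    case False
    obtain B where B: "B \<subseteq> last Ws" "lin_indpt B" "Suc (card B) = length Ws"
      using independent[OF False assms(2,3)] by blast
    have "LinearCombinations.submodule K (last Ws) V"
      using assms(2) False by (auto intro: is_module)
    then have "B \<subseteq> carrier V"
      using B(1) LinearCombinations.submodule.subset by blast
    then have "card B \<le> dim"
      using li_le_dim(2)[OF assms(1) _ B(2)] by blast
    then show ?thesis using B(3) by simp
  qed simp
qed

text \<open>
  The scalar \<open>c\<close> of \<open>K\<close> acts as right multiplication by the element \<open>c \<cdot> 1\<close> of \<open>A\<close>.
\<close>

lemma (in fin_dim_algebra) right_ideal_subspace: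
  assumes "Module.submodule I A (right_regular A)"
  shows "VectorSpace.subspace K I A"
proof -
  note I = submoduleD[OF assms]
  have "c \<odot>\<^bsub>A\<^esub> x \<in> I" if c: "c \<in> carrier K" and x: "x \<in> I" for c x
  proof -
    have xA: "x \<in> carrier A" using I(1) x by auto
    have c1: "c \<odot>\<^bsub>A\<^esub> \<one>\<^bsub>A\<^esub> \<in> carrier A" using c by simp
    have "c \<odot>\<^bsub>A\<^esub> x = x \<otimes>\<^bsub>A\<^esub> (c \<odot>\<^bsub>A\<^esub> \<one>\<^bsub>A\<^esub>)"
      using smult_mult_right[OF c xA alg.one_closed] xA by simp
    then show ?thesis using I(5)[OF c1 x] by simp
  qed
  then show ?thesis
    using I by (auto simp: VectorSpace.subspace_def LinearCombinations.submodule_def vectorspace_axioms module_axioms)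
qed

lemma (in fin_dim_algebra) finite_length_right_regular: "finite_length A (right_regular A)"
  unfolding finite_length_def
  using subspace_chain_length[OF finite_dimensional] right_ideal_subspace by blast

text \<open>
  A functional on a cyclic module is determined by its value at the generator, and evaluation at a
  point is right linear on the dual.
\<close>

lemma finite_length_dual_of_cyclic:
  assumes "finite_length A (right_regular A)" "left_module A M"
    and "x \<in> carrier M" "carrier M = (\<lambda>a. a \<odot>\<^bsub>M\<^esub> x) ` carrier A"
  shows "finite_length A (dual_of_left A M)"
proof -
  interpret M: left_module A M by fact
  interpret D: right_module A "dual_of_left A M" by (rule right_module_dual_of_left) fact
  let ?e = "\<lambda>f\<in>carrier (dual_of_left A M). f x"
  have "?e \<in> Hom A (dual_of_left A M) (right_regular A)"
    using assms(3) dual_of_left_closed[OF assms(2)] by (intro HomI) (auto simp: dual_Hom_apply(1))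
  moreover have "inj_on ?e (carrier (dual_of_left A M))"
  proof (rule inj_onI)
    fix f g assume fg: "f \<in> carrier (dual_of_left A M)" "g \<in> carrier (dual_of_left A M)" "?e f = ?e g"
    then have fg': "f \<in> Hom A M (left_regular A)" "g \<in> Hom A M (left_regular A)" "f x = g x"
      by simp_all
    show "f = g"
    proof (rule Hom_eqI[OF fg'(1,2)])
      fix y assume "y \<in> carrier M"
      then obtain a where "a \<in> carrier A" "y = a \<odot>\<^bsub>M\<^esub> x" using assms(4) by blast
      then show "f y = g y"
        using fg'(3) assms(3) by (simp add: dual_Hom_apply(3)[OF fg'(1)] dual_Hom_apply(3)[OF fg'(2)])
    qed
  qed
  moreover have "operator_group A (dual_of_left A M)" "operator_group A (right_regular A)"
    by (auto intro: right_module_operator_group D.right_module_axioms M.R.right_module_right_regular)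
  ultimately show ?thesis using finite_length_inj_Hom assms(1) by blast
qed

text \<open>
  Any nonzero \<open>x\<close> generates: the multiples of \<open>x\<close> are the image of the regular module under
  \<open>a \<mapsto> a x\<close>, and they contain \<open>1 x = x\<close>.
\<close>

lemma simple_left_module_cyclic:
  assumes "simple_left_module A S"
  obtains x where "x \<in> carrier S" "carrier S = (\<lambda>a. a \<odot>\<^bsub>S\<^esub> x) ` carrier A"
proof -
  interpret S: left_module A S using assms by (simp add: simple_left_module_def)
  interpret og: operator_group A S by (rule left_module_operator_group) unfold_locales
  note rog = left_module_operator_group[OF S.R.left_module_left_regular]
  interpret L: operator_group A "left_regular A" by (rule rog)
  obtain x where x: "x \<in> carrier S" "x \<noteq> \<zero>\<^bsub>S\<^esub>"
    using assms S.M.zero_closed unfolding simple_left_module_def by blast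
  let ?f = "\<lambda>a\<in>carrier (left_regular A). a \<odot>\<^bsub>S\<^esub> x"
  have "?f \<in> Hom A (left_regular A) S"
    using x by (intro HomI) (auto simp: S.smult_closed S.smult_l_distr S.smult_assoc)
  moreover have "Module.submodule (carrier (left_regular A)) A (left_regular A)"
    by (rule L.submoduleI) (use L.op_closed L.a_closed L.a_inv_closed L.zero_closed in auto)
  ultimately have "Module.submodule (?f ` carrier (left_regular A)) A S"
    by (intro Hom_image_submodule[OF _ rog og.operator_group_axioms])
  moreover have "?f ` carrier (left_regular A) = (\<lambda>a. a \<odot>\<^bsub>S\<^esub> x) ` carrier A"
    by auto
  moreover have "x \<in> (\<lambda>a. a \<odot>\<^bsub>S\<^esub> x) ` carrier A"
    using S.smult_one[OF x(1)] by (metis S.R.one_closed imageI)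
  ultimately have "(\<lambda>a. a \<odot>\<^bsub>S\<^esub> x) ` carrier A = carrier S"
    using assms x unfolding simple_left_module_def by (metis singletonD)
  then show ?thesis using that x(1) by metis
qed

section \<open>Duals of simple reflexive modules\<close>

lemma Hom_duals_of_nonisomorphic_simples:
  assumes "simple_left_module A S" "simple_left_module A T" "reflexive_left_module A T"
    and "\<not> isomorphic_modules A S T"
  shows "Hom A (dual_of_left A T) (dual_of_left A S)
    = {\<lambda>f\<in>carrier (dual_of_left A T). \<zero>\<^bsub>dual_of_left A S\<^esub>}"
proof -
  interpret S: left_module A S using assms(1) by (simp add: simple_left_module_def)
  interpret T: left_module A T using assms(2) by (simp add: simple_left_module_def)
  interpret DS: operator_group A "dual_of_left A S"
    by (intro right_module_operator_group right_module_dual_of_left) unfold_locales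
  interpret DT: operator_group A "dual_of_left A T"
    by (intro right_module_operator_group right_module_dual_of_left) unfold_locales
  have "h = (\<lambda>f\<in>carrier (dual_of_left A T). \<zero>\<^bsub>dual_of_left A S\<^esub>)"
    if h: "h \<in> Hom A (dual_of_left A T) (dual_of_left A S)" for h
  proof -
    obtain \<theta> where \<theta>: "\<theta> \<in> Hom A S T" "h = dual_map A S T \<theta>"
      using Hom_between_duals_is_dual_map[OF S.left_module_axioms assms(3) h] .
    have "\<theta> = (\<lambda>x\<in>carrier S. \<zero>\<^bsub>T\<^esub>)"
      using Schur[OF assms(1,2) \<theta>(1)] \<theta>(1) assms(4) unfolding isomorphic_modules_def by blast
    then show ?thesis
      using \<theta>(2) dual_map_zero[OF S.M.abelian_group_axioms T.M.abelian_group_axioms S.R.ring_axioms]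
      by simp
  qed
  then show ?thesis
    using DS.zero_Hom[OF DT.operator_group_axioms] by blast
qed

lemma isomorphic_modules_sym:
  assumes "operator_group A M" "operator_group A N" "isomorphic_modules A M N"
  shows "isomorphic_modules A N M"
proof -
  obtain f where f: "f \<in> Hom A M N" "bij_betw f (carrier M) (carrier N)"
    using assms(3) by (auto simp: isomorphic_modules_def)
  have "bij_betw (\<lambda>y\<in>carrier N. inv_into (carrier M) f y) (carrier N) (carrier M)"
    using bij_betw_inv_into[OF f(2)] by simp
  then show ?thesis
    using Hom_inverse[OF f assms(1,2)] unfolding isomorphic_modules_def by blast
qed

lemma dual_nonzero:
  assumes "reflexive_left_module A S" "carrier S \<noteq> {\<zero>\<^bsub>S\<^esub>}"
  obtains f where "f \<in> Hom A S (left_regular A)" "f \<noteq> (\<lambda>x\<in>carrier S. \<zero>\<^bsub>A\<^esub>)"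
proof -
  interpret S: left_module A S using assms(1) by (simp add: reflexive_left_module_def)
  obtain x where x: "x \<in> carrier S" "x \<noteq> \<zero>\<^bsub>S\<^esub>"
    using assms(2) S.M.zero_closed by blast
  then obtain f where f: "f \<in> Hom A S (left_regular A)" "f x \<noteq> f \<zero>\<^bsub>S\<^esub>"
    using reflexive_separates[OF assms(1) x(1) S.M.zero_closed] by blast
  then show ?thesis
    using that[of f] x(1) S.M.zero_closed by (cases "f = (\<lambda>x\<in>carrier S. \<zero>\<^bsub>A\<^esub>)") simp_all
qed

text \<open>
  An endomorphism of the dual has the form \<open>\<theta>\<^sup>*\<close>; unless it vanishes, \<open>\<theta>\<close> is invertible by Schur's
  lemma, and dualising the inverse inverts \<open>\<theta>\<^sup>*\<close>.
\<close>

lemma End_ring_dual_division_ring: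
  assumes "simple_left_module A S" "reflexive_left_module A S"
  shows "is_division_ring (End_ring A (dual_of_left A S))"
proof -
  interpret S: left_module A S using assms(1) by (simp add: simple_left_module_def)
  interpret og: operator_group A S by (rule left_module_operator_group) unfold_locales
  interpret D: operator_group A "dual_of_left A S"
    by (intro right_module_operator_group right_module_dual_of_left) unfold_locales
  let ?E = "End_ring A (dual_of_left A S)"
  note Sog = og.operator_group_axioms
  interpret E: ring ?E by (rule D.End_ring_is_ring)
  have ne: "\<one>\<^bsub>?E\<^esub> \<noteq> \<zero>\<^bsub>?E\<^esub>"
  proof
    have "carrier S \<noteq> {\<zero>\<^bsub>S\<^esub>}" using assms(1) by (simp add: simple_left_module_def)
    then obtain f where f: "f \<in> Hom A S (left_regular A)" "f \<noteq> (\<lambda>x\<in>carrier S. \<zero>\<^bsub>A\<^esub>)"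
      by (rule dual_nonzero[OF assms(2)])
    assume "\<one>\<^bsub>?E\<^esub> = \<zero>\<^bsub>?E\<^esub>"
    then have "\<one>\<^bsub>?E\<^esub> f = \<zero>\<^bsub>?E\<^esub> f" by (rule fun_cong)
    then show False using f by simp
  qed
  have "h \<in> Units ?E" if h: "h \<in> carrier ?E" "h \<noteq> \<zero>\<^bsub>?E\<^esub>" for h
  proof -
    have hH: "h \<in> Hom A (dual_of_left A S) (dual_of_left A S)" using h(1) by simp
    obtain \<theta> where \<theta>: "\<theta> \<in> Hom A S S" "h = dual_map A S S \<theta>"
      using Hom_between_duals_is_dual_map[OF S.left_module_axioms assms(2) hH] .
    have "\<theta> \<noteq> (\<lambda>x\<in>carrier S. \<zero>\<^bsub>S\<^esub>)"
    proof
      assume "\<theta> = (\<lambda>x\<in>carrier S. \<zero>\<^bsub>S\<^esub>)"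
      then have "h = \<zero>\<^bsub>?E\<^esub>"
        unfolding \<theta>(2) End_ring_simps(4)
        by (simp only: dual_map_zero[OF S.M.abelian_group_axioms S.M.abelian_group_axioms S.R.ring_axioms])
      with h(2) show False by contradiction
    qed
    then have bij: "bij_betw \<theta> (carrier S) (carrier S)"
      using Schur[OF assms(1,1) \<theta>(1)] by blast
    define \<psi> where "\<psi> = (\<lambda>y\<in>carrier S. inv_into (carrier S) \<theta> y)"
    have \<psi>: "\<psi> \<in> Hom A S S"
      unfolding \<psi>_def by (rule Hom_inverse[OF \<theta>(1) bij Sog Sog])
    have inv: "compose (carrier S) \<psi> \<theta> = (\<lambda>x\<in>carrier S. x)" "compose (carrier S) \<theta> \<psi> = (\<lambda>x\<in>carrier S. x)"
      unfolding \<psi>_def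
      by (rule compose_inv_into_id[OF bij], rule compose_id_inv_into[OF bij_betw_imp_surj_on[OF bij]])
    let ?h' = "dual_map A S S \<psi>"
    have "?h' \<otimes>\<^bsub>?E\<^esub> h = \<one>\<^bsub>?E\<^esub>" "h \<otimes>\<^bsub>?E\<^esub> ?h' = \<one>\<^bsub>?E\<^esub>"
      unfolding \<theta>(2) End_ring_simps(2,3)
      by (simp_all only: dual_map_compose[OF Sog \<theta>(1) \<psi> Sog] dual_map_compose[OF Sog \<psi> \<theta>(1) Sog]
          inv dual_map_id)
    moreover have "?h' \<in> carrier ?E"
      unfolding End_ring_simps
      by (rule dual_map_Hom[OF S.left_module_axioms S.left_module_axioms \<psi>])
    ultimately show ?thesis
      unfolding Units_def mem_Collect_eq by (intro conjI h(1) bexI[of _ ?h'])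
  qed
  note nonzero_unit = this
  have zero_not_unit: "\<zero>\<^bsub>?E\<^esub> \<notin> Units ?E"
  proof
    assume "\<zero>\<^bsub>?E\<^esub> \<in> Units ?E"
    then obtain x where x: "x \<in> carrier ?E" "\<zero>\<^bsub>?E\<^esub> \<otimes>\<^bsub>?E\<^esub> x = \<one>\<^bsub>?E\<^esub>"
      using E.Units_r_inv_ex by blast
    have "\<one>\<^bsub>?E\<^esub> = \<zero>\<^bsub>?E\<^esub>"
      using x(2)[symmetric] E.l_null[OF x(1)] by (rule trans)
    then show False using ne by contradiction
  qed
  have "Units ?E = carrier ?E - {\<zero>\<^bsub>?E\<^esub>}"
  proof (rule equalityI; rule subsetI)
    show "h \<in> carrier ?E - {\<zero>\<^bsub>?E\<^esub>}" if "h \<in> Units ?E" for h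
      using that E.Units_closed[OF that] zero_not_unit by blast
    show "h \<in> Units ?E" if "h \<in> carrier ?E - {\<zero>\<^bsub>?E\<^esub>}" for h
      by (rule nonzero_unit) (use that in blast)+
  qed
  then show ?thesis
    unfolding is_division_ring_def by (intro conjI E.ring_axioms ne)
qed

lemma dual_right_brick:
  assumes "fin_dim_algebra K A" "simple_left_module A S" "reflexive_left_module A S"
  shows "right_brick A (dual_of_left A S)"
proof -
  obtain x where x: "x \<in> carrier S" "carrier S = (\<lambda>a. a \<odot>\<^bsub>S\<^esub> x) ` carrier A"
    using simple_left_module_cyclic[OF assms(2)] .
  have S: "left_module A S"
    using assms(2) by (simp add: simple_left_module_def)
  show ?thesis
    unfolding right_brick_def
    by (intro conjI right_module_dual_of_left[OF S] End_ring_dual_division_ring[OF assms(2,3)]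
        finite_length_dual_of_cyclic[OF fin_dim_algebra.finite_length_right_regular[OF assms(1)] S x])
qed

theorem proposition4p2:
  fixes K :: "('k, 'm) ring_scheme"
    and A :: "('k, 'a, 'n) module_scheme"
    and S :: "('a, 'b, 'p) module_scheme"
    and T :: "('a, 'c, 'q) module_scheme"
  assumes "algebraically_closed K"
    and "fin_dim_algebra K A"
    and "simple_left_module A S" and "reflexive_left_module A S"
    and "simple_left_module A T" and "reflexive_left_module A T"
    and "\<not> isomorphic_modules A S T"
  shows "right_brick A (dual_of_left A S) \<and> right_brick A (dual_of_left A T) \<and>
    orthogonal_modules A (dual_of_left A S) (dual_of_left A T)"
proof -
  have "left_module A S" "left_module A T"
    using assms(3,5) by (simp_all add: simple_left_module_def)
  then have og: "operator_group A S" "operator_group A T"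
    by (simp_all add: left_module_operator_group)
  have TS: "\<not> isomorphic_modules A T S"
    by (rule contrapos_nn[OF assms(7) isomorphic_modules_sym[OF og(2,1)]])
  show ?thesis
    unfolding orthogonal_modules_def
    by (intro conjI dual_right_brick[OF assms(2,3,4)] dual_right_brick[OF assms(2,5,6)]
        Hom_duals_of_nonisomorphic_simples[OF assms(3,5,6,7)]
        Hom_duals_of_nonisomorphic_simples[OF assms(5,3,4) TS])
qed

end
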